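(* Let $m$ be any squarefree integer. There is a map $\sigma_m:\mathcal{W}_m^{(2)}\rightarrow \frac14W(\mathbb{Z})$ such that $f_{\sigma_m(a,b)}(x) = x^4+ax+b$ for every $(a,b)\in\mathcal{W}_m^{(2)}$, and such that for every $(a,b)\in\mathcal{W}_m^{(2),\mathrm{irr}}$, the $(1,3)$-entry of any element of $W_{00}(\mathbb{Q})$ that is $G(\mathbb{Z})$-equivalent to $\sigma_m(a,b)$, and the $(1,2)$-entry of any element of $W_{01}(\mathbb{Q})$ that is $G(\mathbb{Z})$-equivalent to $\sigma_m(a,b)$, have absolute value $|m|$.
   Context: Let $\Delta(a,b)=256b^3-27a^4$. For a prime $p$ and $(a,b)\in\mathbb{Z}^2$ with $p^2\mid\Delta(a,b)$, $p^2$ strongly divides $\Delta(a,b)$ if $p^2\mid\Delta(a',b')$ for all integers $a'\equiv a$, $b'\equiv b \pmod p$, and weakly divides it otherwise. $\mathcal{W}_m^{(2)}$ is the set of $(a,b)\in\mathbb{Z}^2$ such that $p^2$ weakly divides $\Delta(a,b)$ for every prime $p\mid m$; $\mathcal{W}_m^{(2),\mathrm{irr}}$ is the subset of those $(a,b)$ for which $x^4+ax+b$ is irreducible over $\mathbb{Q}$ and does not factor as a product of two quadratic polynomials conjugate over some quadratic extension of $\mathbb{Q}$. $A_0$ is the $4\times4$ matrix with $1$'s on the anti-diagonal and $0$'s elsewhere; $W$ is the space of symmetric $4\times 4$ matrices; $f_B(x)=\det(A_0x-B)$; $\frac14W(\mathbb{Z})$ is the set of symmetric $4\times4$ rational matrices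 whose entries have denominators dividing $4$. $G=\mathrm{PSO}(A_0)=\mathrm{SO}(A_0)/\langle\pm I\rangle$ acts on $W$ by $g\cdot B=gBg^t$, and $G(\mathbb{Z})$ is the group of $\mathbb{Z}$-points of this group scheme. $W_{00}$ (resp. $W_{01}$) is the subspace of $W$ of matrices whose $(1,1)$- and $(1,2)$-entries (resp. $(1,1)$- and $(1,3)$-entries) vanish. *)

theory Defs
  imports "HOL-Analysis.Analysis" "HOL-Computational_Algebra.Computational_Algebra"
    "HOL-Number_Theory.Cong"
begin

(* Matrix indices live in the four-element type 4, whose elements are 1, 2, 3 and 4 (with 4 = 0). *)

definition Delta :: "int \<Rightarrow> int \<Rightarrow> int" where
  "Delta a b = 256 * b ^ 3 - 27 * a ^ 4"

definition strongly_divides :: "int \<Rightarrow> int \<Rightarrow> int \<Rightarrow> bool" where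
  "strongly_divides p a b \<longleftrightarrow>
     p\<^sup>2 dvd Delta a b \<and>
     (\<forall>a' b'. [a' = a] (mod p) \<longrightarrow> [b' = b] (mod p) \<longrightarrow> p\<^sup>2 dvd Delta a' b')"

definition weakly_divides :: "int \<Rightarrow> int \<Rightarrow> int \<Rightarrow> bool" where
  "weakly_divides p a b \<longleftrightarrow> p\<^sup>2 dvd Delta a b \<and> \<not> strongly_divides p a b"

definition W_weak :: "int \<Rightarrow> (int \<times> int) set" where
  "W_weak m = {(a, b). \<forall>p. prime p \<longrightarrow> p dvd m \<longrightarrow> weakly_divides p a b}"

definition quartic :: "int \<Rightarrow> int \<Rightarrow> rat poly" where
  "quartic a b = monom 1 4 + smult (of_int a) (monom 1 1) + [:of_int b:]"

(* Every quadratic extension of the rationals is generated by a square root s of some non-square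
   rational d; a polynomial over it is u + s v with u, v rational, and its conjugate is u - s v. *)
definition product_of_conjugate_quadratics :: "rat poly \<Rightarrow> bool" where
  "product_of_conjugate_quadratics f \<longleftrightarrow>
     (\<exists>(d::rat) (s::complex) (u::rat poly) (v::rat poly).
        (\<nexists>r::rat. r\<^sup>2 = d) \<and> s\<^sup>2 = of_rat d \<and>
        (let g = map_poly of_rat u + smult s (map_poly of_rat v);
             g' = map_poly of_rat u - smult s (map_poly of_rat v)
         in degree g = 2 \<and> degree g' = 2 \<and> map_poly of_rat f = g * g'))"

definition W_weak_irr :: "int \<Rightarrow> (int \<times> int) set" where
  "W_weak_irr m = {(a, b) \<in> W_weak m.
     irreducible (quartic a b) \<and> \<not> product_of_conjugate_quadratics (quartic a b)}"

(* For indices 1, ..., 4 one has 2 <= i + j <= 8, so i + j = 5 in the type 4 (arithmetic modulo 4)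
   also means i + j = 5 as integers: this is the anti-diagonal. *)
definition A0 :: "'a::{zero,one} ^ 4 ^ 4" where
  "A0 = (\<chi> i j. if i + j = 5 then 1 else 0)"

definition inv_poly :: "rat ^ 4 ^ 4 \<Rightarrow> rat poly" where
  "inv_poly B = det (map_matrix (\<lambda>c. monom c 1) A0 - map_matrix (\<lambda>c. [:c:]) B)"

definition W_Q :: "(rat ^ 4 ^ 4) set" where
  "W_Q = {B. transpose B = B}"

definition quarter_W_Z :: "(rat ^ 4 ^ 4) set" where
  "quarter_W_Z = {B \<in> W_Q. \<forall>i j. 4 * B $ i $ j \<in> \<int>}"

definition W00_Q :: "(rat ^ 4 ^ 4) set" where
  "W00_Q = {B \<in> W_Q. B $ 1 $ 1 = 0 \<and> B $ 1 $ 2 = 0}"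

definition W01_Q :: "(rat ^ 4 ^ 4) set" where
  "W01_Q = {B \<in> W_Q. B $ 1 $ 1 = 0 \<and> B $ 1 $ 3 = 0}"

definition SO_A0 :: "(complex ^ 4 ^ 4) set" where
  "SO_A0 = {g. g ** A0 ** transpose g = A0 \<and> det g = 1}"

definition PSO_A0 :: "(complex ^ 4 ^ 4) set set" where
  "PSO_A0 = {{g, - g} | g. g \<in> SO_A0}"

(* The coordinate ring of the affine group scheme SO(A0)/mu_2 consists of the even-degree elements
   of the coordinate ring of SO(A0), hence is generated over the integers by the products
   g_ij g_kl.  A Z-point is therefore a complex point of the quotient at which all these products
   take integer values.  Its representatives g need not be integral: {g, -g} with
   g = i h, h integral, h A0 h^t = - A0 and det h = 1 is a Z-point not coming from SO(A0)(Z). *)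
definition G_Z :: "(complex ^ 4 ^ 4) set set" where
  "G_Z = {X \<in> PSO_A0. \<forall>g\<in>X. \<forall>i j k l. g $ i $ j * g $ k $ l \<in> \<int>}"

definition G_Z_equivalent :: "rat ^ 4 ^ 4 \<Rightarrow> rat ^ 4 ^ 4 \<Rightarrow> bool" where
  "G_Z_equivalent B C \<longleftrightarrow>
     (\<exists>X\<in>G_Z. \<exists>g\<in>X. map_matrix of_rat C = g ** map_matrix of_rat B ** transpose g)"

end

theory Submission
  imports Defs
begin

text \<open>
  Every prime dividing \<open>m\<close> is prime to \<open>3a\<close>, so \<open>3ar \<equiv> -4b (mod m\<^sup>2)\<close> has a solution \<open>r\<close>, and this is a
  double root of \<open>f = x\<^sup>4 + ax + b\<close> in the sense that \<open>m\<^sup>2 | f(r)\<close> and \<open>m | f'(r)\<close>. Expanding \<open>f\<close> around \<open>r\<close>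
  gives a matrix \<open>B\<close> in \<open>W\<^sub>0\<^sub>0\<close> with invariant polynomial \<open>f\<close> and (1,3)-entry \<open>m\<close>.

  Put \<open>T = B A\<^sub>0\<close>; it is self-adjoint for the form \<open>A\<^sub>0\<close>. If \<open>g\<close> carries \<open>B\<close> to \<open>C\<close> in \<open>W\<^sub>0\<^sub>0\<close> or \<open>W\<^sub>0\<^sub>1\<close>, then
  the first row \<open>v\<close> of \<open>g\<close> is proportional to a rational vector, and \<open>v\<close> and \<open>vT\<close> span an isotropic
  subspace. Write \<open>v = e\<^sub>1 p(T)\<close>. Because \<open>e\<^sub>1\<close> and \<open>e\<^sub>1 T\<close> span an isotropic subspace as well, this says
  that \<open>p\<^sup>2\<close> is congruent to a rational constant modulo \<open>f\<close>. A non-constant such \<open>p\<close> would make \<open>f\<close>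
  reducible or a product of two conjugate quadratics, so \<open>v\<close> is a multiple of \<open>e\<^sub>1\<close>, and
  \<open>e\<^sub>1 C A\<^sub>0 g = v T\<close> shows that \<open>g\<close> preserves the flag \<open>e\<^sub>1, e\<^sub>2\<close> (for \<open>W\<^sub>0\<^sub>0\<close>) or moves it to the flag
  \<open>e\<^sub>1, e\<^sub>3\<close> (for \<open>W\<^sub>0\<^sub>1\<close>). The second is impossible for \<open>det g = 1\<close>: the (1,2)-entry claim is vacuous.
  In the first case the (1,3)-entry is multiplied by a diagonal character of \<open>g\<close>, an integral unit.
\<close>

no_notation fps_nth (infixl "$" 75)

section \<open>Weak divisibility and double roots\<close>

text \<open>If p divides 3a, divisibility of Delta(a,b) by p^2 persists on the whole residue class.
  The term 27a^4 is covered by 27 when p = 3 and by a^4 otherwise; the term 256b^3 is covered by 256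
  when p = 2, and for odd p because p must then divide b.\<close>

lemma weakly_divides_coprime:
  fixes p :: int
  assumes "prime p" "weakly_divides p a b"
  shows "\<not> p dvd 3 * a"
proof
  assume pa: "p dvd 3 * a"
  have D: "p\<^sup>2 dvd Delta a b" and nS: "\<not> strongly_divides p a b"
    using assms by (auto simp: weakly_divides_def)
  have p2: "prime (2::int)" and p3: "prime (3::int)" by simp_all
  have pb: "p dvd b" if "p \<noteq> 2" "p\<^sup>2 dvd 27 * a ^ 4"
  proof -
    have "p\<^sup>2 dvd 256 * b ^ 3"
      using dvd_add[OF D that(2)] by (simp add: Delta_def)
    then have "p dvd 2 ^ 8 * b ^ 3"
      using dvd_trans[of p "p\<^sup>2"] by simp
    moreover have "\<not> p dvd 2"
      using that(1) assms(1) p2 primes_dvd_imp_eq by blast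
    ultimately show ?thesis
      using assms(1) prime_dvd_mult_iff prime_dvd_power_iff by (metis prime_dvd_power)
  qed
  have b_strong: False if "p dvd b" "\<And>a'. [a' = a] (mod p) \<Longrightarrow> p\<^sup>2 dvd 27 * a' ^ 4"
  proof -
    have "p\<^sup>2 dvd Delta a' b'" if "[a' = a] (mod p)" "[b' = b] (mod p)" for a' b'
    proof -
      have "p dvd b'" using \<open>p dvd b\<close> that(2) cong_dvd_iff by blast
      then have "p\<^sup>2 dvd b' ^ 3" using dvd_power_same[of p b' 2] dvd_power_le[of p b' 2 3] by simp
      then show ?thesis using \<open>\<And>a'. [a' = a] (mod p) \<Longrightarrow> p\<^sup>2 dvd 27 * a' ^ 4\<close> that(1)
        by (simp add: Delta_def)
    qed
    then show False using nS D by (simp add: strongly_divides_def)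
  qed
  have a4: "p\<^sup>2 dvd x ^ 4" if "p dvd x" for x
    using that dvd_power_le[of p x 2 4] by simp
  show False
  proof (cases "p = 3")
    case True
    then have "p\<^sup>2 dvd 27 * x" for x :: int by simp
    with b_strong pb True show False by auto
  next
    case False
    then have "\<not> p dvd 3" using assms(1) p3 primes_dvd_imp_eq by blast
    then have pa: "p dvd a" using pa assms(1) prime_dvd_mult_iff by blast
    have a': "p dvd a'" if "[a' = a] (mod p)" for a' using pa that cong_dvd_iff by blast
    show False
    proof (cases "p = 2")
      case True
      have "p\<^sup>2 dvd Delta a' b'" if "[a' = a] (mod p)" for a' b'
        using a4[OF a'[OF that]] True by (auto simp: Delta_def intro!: dvd_diff)
      then show False using nS D by (simp add: strongly_divides_def)
    next
      case False
      show False by (rule b_strong) (use pb[OF False] a4 pa a' in auto)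
    qed
  qed
qed

text \<open>Squarefreeness bounds every prime multiplicity in m^2 by 2, so both claims can be
  checked prime by prime.\<close>

lemma W_weak_square_dvd:
  assumes "squarefree m" "(a, b) \<in> W_weak m"
  shows "coprime (3 * a) (m\<^sup>2)" "m\<^sup>2 dvd Delta a b"
proof -
  have m0: "m \<noteq> 0" using assms(1) by auto
  have wd: "weakly_divides p a b" if "prime p" "p dvd m" for p
    using assms(2) that by (simp add: W_weak_def)
  show "coprime (3 * a) (m\<^sup>2)"
  proof (rule ccontr)
    assume "\<not> coprime (3 * a) (m\<^sup>2)"
    then have "\<not> coprime (3 * a) m" by simp
    then have "\<not> is_unit (gcd (3 * a) m)" by (simp add: coprime_iff_gcd_eq_1)
    then obtain p where "prime p" "p dvd gcd (3 * a) m"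
      using prime_divisor_exists[of "gcd (3 * a) m"] m0 by auto
    with wd weakly_divides_coprime show False by auto
  qed
  show "m\<^sup>2 dvd Delta a b"
  proof (cases "Delta a b = 0")
    case False
    show ?thesis
    proof (rule multiplicity_le_imp_dvd)
      fix p :: int
      assume p: "prime p"
      have mult: "multiplicity p (m\<^sup>2) = 2 * multiplicity p m"
        using prime_elem_multiplicity_power_distrib[OF prime_imp_prime_elem[OF p] m0] .
      have le1: "multiplicity p m \<le> 1"
        using assms(1) m0 p squarefree_factorial_semiring'' by blast
      show "multiplicity p (m\<^sup>2) \<le> multiplicity p (Delta a b)"
      proof (cases "p dvd m")
        case True
        then have "p\<^sup>2 dvd Delta a b" using wd p by (simp add: weakly_divides_def)
        then have "2 \<le> multiplicity p (Delta a b)"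
          using False p by (intro multiplicity_geI) auto
        then show ?thesis using le1 mult by simp
      next
        case False
        then show ?thesis using mult by (simp add: not_dvd_imp_multiplicity_0)
      qed
    qed (use m0 in simp)
  qed simp
qed

text \<open>For f = x^4 + ax + b, the identity 4f - x f' = 3ax + 4b singles out r = -4b/(3a) modulo
  m^2. There f(r) and f'(r), multiplied by powers of the unit 3a, become multiples of
  Delta(a,b).\<close>

lemma W_weak_double_root:
  assumes "squarefree m" "(a, b) \<in> W_weak m"
  shows "\<exists>r. m dvd 4 * r ^ 3 + a \<and> m\<^sup>2 dvd r ^ 4 + a * r + b"
proof -
  note cop = W_weak_square_dvd(1)[OF assms] and D = W_weak_square_dvd(2)[OF assms]
  obtain y where y: "[3 * a * y = 1] (mod m\<^sup>2)"
    using cong_solve_coprime_int[OF cop] by auto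
  define r where "r = - 4 * b * y"
  have "[3 * a * r = - 4 * b] (mod m\<^sup>2)"
    using cong_scalar_left[OF y, of "- 4 * b"] by (simp add: r_def mult_ac)
  then have ar: "[(3 * a * r) ^ n = (- 4 * b) ^ n] (mod m\<^sup>2)" for n by (rule cong_pow)
  have "[(3 * a) ^ 4 * (r ^ 4 + a * r + b) = b * Delta a b] (mod m\<^sup>2)"
  proof -
    have "(3 * a) ^ 4 * (r ^ 4 + a * r + b) = (3 * a * r) ^ 4 + 27 * a ^ 4 * (3 * a * r) ^ 1 + 81 * a ^ 4 * b"
      by algebra
    also have "[\<dots> = (- 4 * b) ^ 4 + 27 * a ^ 4 * (- 4 * b) ^ 1 + 81 * a ^ 4 * b] (mod m\<^sup>2)"
      by (intro cong_add cong_mult ar cong_refl)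
    also have "(- 4 * b) ^ 4 + 27 * a ^ 4 * (- 4 * b) ^ 1 + 81 * a ^ 4 * b = b * Delta a b"
      by (simp add: Delta_def algebra_simps power_mult_distrib eval_nat_numeral)
    finally show ?thesis .
  qed
  then have "m\<^sup>2 dvd (3 * a) ^ 4 * (r ^ 4 + a * r + b)"
    using D cong_dvd_iff dvd_mult cong_dvd_iff by (metis cong_0_iff cong_trans)
  moreover have "coprime (m\<^sup>2) ((3 * a) ^ n)" for n
    using cop by (simp add: coprime_commute)
  ultimately have 1: "m\<^sup>2 dvd r ^ 4 + a * r + b"
    using coprime_dvd_mult_right_iff by blast
  have "[(3 * a) ^ 3 * (4 * r ^ 3 + a) = - Delta a b] (mod m\<^sup>2)"
  proof -
    have "(3 * a) ^ 3 * (4 * r ^ 3 + a) = 4 * (3 * a * r) ^ 3 + 27 * a ^ 4"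
      by algebra
    also have "[\<dots> = 4 * (- 4 * b) ^ 3 + 27 * a ^ 4] (mod m\<^sup>2)"
      by (intro cong_add cong_mult ar cong_refl)
    also have "4 * (- 4 * b) ^ 3 + 27 * a ^ 4 = - Delta a b"
      by (simp add: Delta_def algebra_simps power_mult_distrib eval_nat_numeral)
    finally show ?thesis .
  qed
  then have "m\<^sup>2 dvd (3 * a) ^ 3 * (4 * r ^ 3 + a)"
    using D by (metis cong_0_iff cong_trans dvd_minus_iff)
  then have "m\<^sup>2 dvd 4 * r ^ 3 + a"
    using \<open>\<And>n. coprime (m\<^sup>2) ((3 * a) ^ n)\<close> coprime_dvd_mult_right_iff by blast
  then have "m dvd 4 * r ^ 3 + a" using dvd_trans[of m "m\<^sup>2"] by simp
  with 1 show ?thesis by blast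
qed

section \<open>Squares in the quartic field\<close>

lemma map_poly_of_rat_mult:
  "map_poly (of_rat :: rat \<Rightarrow> complex) (p * q) = map_poly of_rat p * map_poly of_rat q"
  by (rule poly_eqI) (simp add: coeff_map_poly coeff_mult of_rat_sum of_rat_mult)

lemma square_neq_smult_square:
  fixes u l :: "rat poly"
  assumes "\<nexists>\<rho>::rat. \<rho>\<^sup>2 = d" "l \<noteq> 0"
  shows "u\<^sup>2 \<noteq> smult d (l\<^sup>2)"
proof
  assume "u\<^sup>2 = smult d (l\<^sup>2)"
  then have "lead_coeff (u\<^sup>2) = lead_coeff (smult d (l\<^sup>2))" by (rule arg_cong)
  then have "(lead_coeff u)\<^sup>2 = d * (lead_coeff l)\<^sup>2"
    by (simp only: lead_coeff_power lead_coeff_smult)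
  then have "(lead_coeff u / lead_coeff l)\<^sup>2 = d"
    using assms(2) by (simp add: power_divide)
  with assms(1) show False by blast
qed

text \<open>By degree, the nonzero polynomial u^2 - d l^2 is a constant multiple of f, and the
  constant is the square of the leading coefficient of u. Rescaling gives f = U^2 - d V^2, which
  splits over the field generated by a square root of d.\<close>

lemma product_of_conjugate_quadraticsI:
  fixes f u l :: "rat poly"
  assumes f: "degree f = 4" "lead_coeff f = 1"
    and d: "\<nexists>\<rho>::rat. \<rho>\<^sup>2 = d"
    and u: "degree u \<le> 2" and l: "degree l \<le> 1" "l \<noteq> 0"
    and dvd: "f dvd u\<^sup>2 - smult d (l\<^sup>2)"
  shows "product_of_conjugate_quadratics f"
proof -
  have f0: "f \<noteq> 0" using f by auto
  obtain c where c: "u\<^sup>2 - smult d (l\<^sup>2) = f * c" using dvd by (elim dvdE)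
  have c0: "c \<noteq> 0" using square_neq_smult_square[OF d l(2), of u] c by auto
  have du2: "degree (u\<^sup>2) = 2 * degree u"
    by (cases "u = 0") (simp_all add: power2_eq_square degree_mult_eq)
  have dl2: "degree (smult d (l\<^sup>2)) \<le> 2"
    using l degree_power_le[of l 2] degree_smult_le[of d "l\<^sup>2"] by linarith
  have dfc: "degree (f * c) = 4 + degree c" using f0 c0 f by (simp add: degree_mult_eq)
  have "degree (u\<^sup>2 - smult d (l\<^sup>2)) \<le> 4"
    using du2 dl2 u by (intro degree_diff_le) auto
  then have dc: "degree c = 0" using dfc c by simp
  then obtain k where k: "c = [:k:]" by (rule degree_eq_zeroE)
  have "degree (u\<^sup>2) = 4"
  proof (rule ccontr)
    assume "degree (u\<^sup>2) \<noteq> 4"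
    then have "degree (u\<^sup>2) < 4" using du2 u by simp
    then have "degree (u\<^sup>2 - smult d (l\<^sup>2)) < 4" using dl2 by (intro degree_diff_less) auto
    then show False using dfc c by simp
  qed
  then have du: "degree u = 2" using du2 by simp
  define \<kappa> where "\<kappa> = lead_coeff u"
  have "u \<noteq> 0" using du by auto
  then have \<kappa>0: "\<kappa> \<noteq> 0" by (simp add: \<kappa>_def)
  have "coeff (u\<^sup>2 - smult d (l\<^sup>2)) 4 = coeff (u\<^sup>2) 4"
    using dl2 by (simp add: coeff_eq_0 coeff_diff del: coeff_smult)
  also have "\<dots> = \<kappa>\<^sup>2"
    using \<open>degree (u\<^sup>2) = 4\<close> lead_coeff_power[of u 2] by (simp add: \<kappa>_def)
  finally have "k = \<kappa>\<^sup>2" using f by (simp add: c k)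
  define U V where "U = smult (1 / \<kappa>) u" and "V = smult (1 / \<kappa>) l"
  have "smult (1 / \<kappa>\<^sup>2) (u\<^sup>2 - smult d (l\<^sup>2)) = f"
    using \<kappa>0 by (simp add: c k \<open>k = \<kappa>\<^sup>2\<close>)
  then have fUV: "f = U * U - smult d (V * V)"
    by (simp add: U_def V_def smult_diff_right power2_eq_square mult_ac)
  define s where "s = csqrt (of_rat d)"
  have s2: "s * s = of_rat d" using power2_csqrt[of "of_rat d"] by (simp add: s_def power2_eq_square)
  let ?m = "map_poly (of_rat :: rat \<Rightarrow> complex)"
  have degm: "degree (?m q) = degree q" for q by (simp add: degree_map_poly)
  have dU: "degree (?m U) = 2" using du \<kappa>0 by (simp add: degm U_def)
  have dV: "degree (smult s (?m V)) < 2" "degree (smult (- s) (?m V)) < 2"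
    using l degree_smult_le[of s "?m V"] degree_smult_le[of "- s" "?m V"]
      degree_smult_le[of "1 / \<kappa>" l] by (auto simp add: degm V_def)
  have mf: "?m f = ?m (U * U) - smult (of_rat d) (?m (V * V))"
    unfolding fUV by (rule poly_eqI) (simp add: coeff_map_poly of_rat_diff of_rat_mult)
  have eq: "?m f = (?m U + smult s (?m V)) * (?m U - smult s (?m V))"
    unfolding mf map_poly_of_rat_mult s2[symmetric]
    by (simp add: algebra_simps)
  have "degree (?m U + smult s (?m V)) = 2" "degree (?m U - smult s (?m V)) = 2"
    using degree_add_eq_left[of "smult s (?m V)" "?m U"] degree_add_eq_left[of "smult (- s) (?m V)" "?m U"]
      dU dV by simp_all
  with eq d s2 show ?thesis
    unfolding product_of_conjugate_quadratics_def
    by (intro exI[of _ d] exI[of _ s] exI[of _ U] exI[of _ V]) (simp add: power2_eq_square)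
qed

lemma quartic_conv: "quartic a b = [:of_int b, of_int a, 0, 0, 1:]"
  by (simp add: quartic_def monom_altdef numeral_eq_Suc)

text \<open>If d is a rational square, the prime f divides a factor of p^2 - d of degree at most 3,
  so that factor is zero. If not, multiplying p by a suitable l of degree at most 1 and reducing
  modulo f gives u of degree at most 2 with u^2 = d l^2 modulo f, a conjugate factorization.\<close>

lemma square_constant_mod_quartic:
  fixes p0 p1 p2 p3 d :: rat
  defines "p \<equiv> [:p0, p1, p2, p3:]"
  assumes irr: "irreducible (quartic a b)"
    and npc: "\<not> product_of_conjugate_quadratics (quartic a b)"
    and dvd: "quartic a b dvd p\<^sup>2 - [:d:]"
  shows "p1 = 0 \<and> p2 = 0 \<and> p3 = 0"
proof (cases "\<exists>\<rho>::rat. \<rho>\<^sup>2 = d")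
  case True
  then obtain \<rho> where "\<rho>\<^sup>2 = d" by blast
  then have "p\<^sup>2 - [:d:] = (p - [:\<rho>:]) * (p + [:\<rho>:])"
    by (simp add: algebra_simps power2_eq_square)
  moreover have "prime_elem (quartic a b)" using irr by (rule field_poly_irreducible_imp_prime)
  ultimately have "quartic a b dvd p - [:\<rho>:] \<or> quartic a b dvd p + [:\<rho>:]"
    using dvd prime_elem_dvd_mult_iff by metis
  moreover have "q = 0" if "quartic a b dvd q" "degree q \<le> 3" for q
    using dvd_imp_degree_le[OF that(1)] that(2) by (cases "q = 0") (auto simp: quartic_conv)
  moreover have "degree (p - [:\<rho>:]) \<le> 3" "degree (p + [:\<rho>:]) \<le> 3" by (simp_all add: p_def)
  ultimately have "p - [:\<rho>:] = 0 \<or> p + [:\<rho>:] = 0" by blast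
  then show ?thesis by (auto simp: p_def)
next
  case False
  \<comment> \<open>The factor \<open>l\<close> is chosen so that \<open>p l\<close> has no cubic term modulo the quartic.\<close>
  define l where "l = (if p3 = 0 then 1 else [:- p2, p3:])"
  define u where "u = p * l - smult (p3\<^sup>2) (quartic a b)"
  have l: "degree l \<le> 1" "l \<noteq> 0" by (auto simp: l_def)
  have u: "degree u \<le> 2"
    by (auto simp: u_def l_def p_def quartic_conv power2_eq_square)
  have "u\<^sup>2 - smult d (l\<^sup>2) = l\<^sup>2 * (p\<^sup>2 - [:d:]) +
      quartic a b * (smult (p3 ^ 4) (quartic a b) - smult (2 * p3\<^sup>2) (p * l))"
    by (simp add: u_def algebra_simps power2_eq_square power4_eq_xxxx numeral_poly flip: mult_2)
  then have "quartic a b dvd u\<^sup>2 - smult d (l\<^sup>2)" using dvd by simp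
  then have "product_of_conjugate_quadratics (quartic a b)"
    using product_of_conjugate_quadraticsI[of "quartic a b" d u l] False u l
    by (simp add: quartic_conv)
  with npc show ?thesis by blast
qed

text \<open>\<open>E1\<close>, \<open>E2\<close>, \<open>E3\<close> say that v and vT span an
  isotropic subspace. As m is nonzero, the e_1 T^i for i < 4 form a basis; they pair with e_1 to 0,
  0, 0, m^2. By self-adjointness, pairing e_1 h(T) with e_1 reads off the x^3-coefficient of h
  modulo f; here h is p^2, x p^2 and x^2 p^2.\<close>

lemma isotropic_row_trivial:
  fixes m r \<beta> \<gamma> v1 v2 v3 v4 :: rat
  assumes m0: "m \<noteq> 0"
    and a: "of_int a = - 4 * r ^ 3 - 2 * m * \<beta>"
    and b: "of_int b = - (r ^ 4) - of_int a * r - m\<^sup>2 * \<gamma>"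
    and irr: "irreducible (quartic a b)"
    and npc: "\<not> product_of_conjugate_quadratics (quartic a b)"
    and E1: "v1 * v4 + v2 * v3 = 0"
    and E2: "v1 * (m * v3 + r * v4) + v2 * (v2 - r * v3)
      + v3 * (m * v1 - r * v2 - 2 * r\<^sup>2 * v3 + \<beta> * v4) + v4 * (r * v1 + \<beta> * v3 + \<gamma> * v4) = 0"
    and E3: "(m * v3 + r * v4) * (r * v1 + \<beta> * v3 + \<gamma> * v4)
      + (v2 - r * v3) * (m * v1 - r * v2 - 2 * r\<^sup>2 * v3 + \<beta> * v4) = 0"
  shows "v2 = 0 \<and> v3 = 0 \<and> v4 = 0"
proof -
  \<comment> \<open>\<open>v = e\<^sub>1 (p0 + p1 T + p2 T\<^sup>2 + p3 T\<^sup>3)\<close>; the hypotheses \<open>E1\<close>, \<open>E2\<close>, \<open>E3\<close> kill the coefficients of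
    \<open>x\<^sup>3\<close>, \<open>x\<^sup>2\<close>, \<open>x\<close> of \<open>(p0 + p1 x + p2 x\<^sup>2 + p3 x\<^sup>3)\<^sup>2\<close> modulo the quartic.\<close>
  define p3 where "p3 = v4 / m\<^sup>2"
  define p2 where "p2 = v3 / m + r * p3"
  define p1 where "p1 = v2 / m + r\<^sup>2 * p3"
  define p0 where "p0 = v1 - p1 * r - p2 * r\<^sup>2 - p3 * (r ^ 3 + m * \<beta>)"
  have v4: "v4 = m\<^sup>2 * p3" using m0 by (simp add: p3_def)
  have v3: "v3 = m * p2 - m * r * p3" using m0 by (simp add: p2_def field_simps)
  have v2: "v2 = m * p1 - m * r\<^sup>2 * p3" using m0 by (simp add: p1_def field_simps)
  have v1: "v1 = p0 + p1 * r + p2 * r\<^sup>2 + p3 * (r ^ 3 + m * \<beta>)" by (simp add: p0_def)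
  define A B where "A = (of_int a :: rat)" and "B = (of_int b :: rat)"
  note a' = a[folded A_def] and b' = b[folded A_def B_def]
  \<comment> \<open>These are the coefficients of x, ..., x^6 in the square; its quotient by the
    quartic will be q4 + q5 x + q6 x^2.\<close>
  define q1 q2 q3 q4 q5 q6 where "q1 = 2 * p0 * p1" and "q2 = 2 * p0 * p2 + p1\<^sup>2"
    and "q3 = 2 * p0 * p3 + 2 * p1 * p2" and "q4 = 2 * p1 * p3 + p2\<^sup>2" and "q5 = 2 * p2 * p3"
    and "q6 = p3\<^sup>2"
  note q = q1_def q2_def q3_def q4_def q5_def q6_def
  have "m\<^sup>2 * (q3 - A * q6) = 0" using E1 unfolding v1 v2 v3 v4 a' q by algebra
  then have s3: "q3 = A * q6" using m0 by simp
  have "m\<^sup>2 * (q2 - A * q5 - B * q6) = 0" using E2 unfolding v1 v2 v3 v4 b' a' q by algebra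
  then have s2: "q2 = A * q5 + B * q6" using m0 by simp
  have "m\<^sup>2 * (q1 - A * q4 - B * q5) = 0" using E3 s3 unfolding v1 v2 v3 v4 b' a' q by algebra
  then have s1: "q1 = A * q4 + B * q5" using m0 by simp
  define \<delta> where "\<delta> = p0\<^sup>2 - B * q4"
  have "[:p0, p1, p2, p3:]\<^sup>2 - [:\<delta>:] = [:B * q4, q1, q2, q3, q4, q5, q6:]"
    by (simp add: \<delta>_def q power2_eq_square algebra_simps)
  also have "\<dots> = quartic a b * [:q4, q5, q6:]"
    unfolding s1 s2 s3 by (simp add: quartic_conv algebra_simps flip: A_def B_def)
  finally have "quartic a b dvd [:p0, p1, p2, p3:]\<^sup>2 - [:\<delta>:]" by (rule dvdI)
  from square_constant_mod_quartic[OF irr npc this] show ?thesis by (simp add: v2 v3 v4)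
qed

section \<open>Matrices of size four\<close>

lemma det_4:
  "det (A :: 'a::comm_ring_1^4^4) =
    A$1$1 * (A$2$2 * (A$3$3 * A$4$4 - A$3$4 * A$4$3) - A$2$3 * (A$3$2 * A$4$4 - A$3$4 * A$4$2)
      + A$2$4 * (A$3$2 * A$4$3 - A$3$3 * A$4$2))
    - A$1$2 * (A$2$1 * (A$3$3 * A$4$4 - A$3$4 * A$4$3) - A$2$3 * (A$3$1 * A$4$4 - A$3$4 * A$4$1)
      + A$2$4 * (A$3$1 * A$4$3 - A$3$3 * A$4$1))
    + A$1$3 * (A$2$1 * (A$3$2 * A$4$4 - A$3$4 * A$4$2) - A$2$2 * (A$3$1 * A$4$4 - A$3$4 * A$4$1)
      + A$2$4 * (A$3$1 * A$4$2 - A$3$2 * A$4$1))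
    - A$1$4 * (A$2$1 * (A$3$2 * A$4$3 - A$3$3 * A$4$2) - A$2$2 * (A$3$1 * A$4$3 - A$3$3 * A$4$1)
      + A$2$3 * (A$3$1 * A$4$2 - A$3$2 * A$4$1))"
proof -
  have f1234: "finite {2::4, 3, 4}" "1 \<notin> {2::4, 3, 4}" by auto
  have f234: "finite {3::4, 4}" "2 \<notin> {3::4, 4}" by auto
  have f34: "finite {4::4}" "3 \<notin> {4::4}" by auto
  show ?thesis
    unfolding det_def UNIV_4
    unfolding sum_over_permutations_insert[OF f1234]
    unfolding sum_over_permutations_insert[OF f234]
    unfolding sum_over_permutations_insert[OF f34]
    unfolding permutes_sing
    by (simp add: sign_swap_id permutation_swap_id permutation_compose sign_compose sign_id swap_id_eq algebra_simps)
qed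

lemma A0_nth:
  "A0 $ 1 $ 1 = 0" "A0 $ 1 $ 2 = 0" "A0 $ 1 $ 3 = 0" "A0 $ 1 $ 4 = 1"
  "A0 $ 2 $ 1 = 0" "A0 $ 2 $ 2 = 0" "A0 $ 2 $ 3 = 1" "A0 $ 2 $ 4 = 0"
  "A0 $ 3 $ 1 = 0" "A0 $ 3 $ 2 = 1" "A0 $ 3 $ 3 = 0" "A0 $ 3 $ 4 = 0"
  "A0 $ 4 $ 1 = 1" "A0 $ 4 $ 2 = 0" "A0 $ 4 $ 3 = 0" "A0 $ 4 $ 4 = 0"
  by (simp_all add: A0_def)

lemma A0_gram:
  fixes h :: "'a::comm_semiring_1 ^ 4 ^ 'n::finite"
  shows "(h ** A0 ** transpose h) $ i $ j =
    h $ i $ 1 * h $ j $ 4 + h $ i $ 2 * h $ j $ 3 + h $ i $ 3 * h $ j $ 2 + h $ i $ 4 * h $ j $ 1"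
  by (simp add: matrix_matrix_mult_def sum_4 A0_nth transpose_def algebra_simps)

lemma A0_square: "(A0 :: 'a::semiring_1^4^4) ** A0 = mat 1"
  by (simp add: vec_eq_iff forall_4 matrix_matrix_mult_def sum_4 A0_nth mat_def)

section \<open>The matrix attached to a double root\<close>

definition vec4 :: "'a \<Rightarrow> 'a \<Rightarrow> 'a \<Rightarrow> 'a \<Rightarrow> 'a ^ 4" where
  "vec4 x y z w = (\<chi> i. if i = 1 then x else if i = 2 then y else if i = 3 then z else w)"

lemma vec4_nth [simp]:
  "vec4 x y z w $ 1 = x" "vec4 x y z w $ 2 = y" "vec4 x y z w $ 3 = z" "vec4 x y z w $ 4 = w"
  by (simp_all add: vec4_def)

text \<open>
  The invariant polynomial of this matrix is
  \<open>(x\<^sup>2 - r\<^sup>2)\<^sup>2 + 2 r\<^sup>2 (x - r)\<^sup>2 - 2 m \<beta> (x - r) - m\<^sup>2 \<gamma>\<close>.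
\<close>

definition section_matrix :: "rat \<Rightarrow> rat \<Rightarrow> rat \<Rightarrow> rat \<Rightarrow> rat ^ 4 ^ 4" where
  "section_matrix m r \<beta> \<gamma> =
     vec4 (vec4 0 0 m r) (vec4 0 1 (- r) 0) (vec4 m (- r) (- 2 * r\<^sup>2) \<beta>) (vec4 r 0 \<beta> \<gamma>)"

text \<open>The hypotheses read f'(r) = -2 m \<open>\<beta>\<close> and f(r) = -m^2
  \<open>\<gamma>\<close>. Comparing values at every rational x turns the claim into an identity of
  scalars.\<close>

lemma inv_poly_section_matrix:
  assumes "of_int a = - 4 * r ^ 3 - 2 * m * \<beta>"
    and "of_int b = - (r ^ 4) - of_int a * r - m\<^sup>2 * \<gamma>"
  shows "inv_poly (section_matrix m r \<beta> \<gamma>) = quartic a b"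
proof -
  have "poly (inv_poly (section_matrix m r \<beta> \<gamma>)) x = poly (quartic a b) x" for x
    unfolding inv_poly_def det_4 quartic_conv
    by (simp add: section_matrix_def A0_nth assms poly_monom) algebra
  then have "poly (inv_poly (section_matrix m r \<beta> \<gamma>)) = poly (quartic a b)" by (rule ext)
  then show ?thesis by (simp only: poly_eq_poly_eq_iff)
qed

lemma section_matrix_in_quarter_W_Z:
  assumes "4 * m \<in> \<int>" "4 * r \<in> \<int>" "8 * r\<^sup>2 \<in> \<int>" "4 * \<beta> \<in> \<int>" "4 * \<gamma> \<in> \<int>"
  shows "section_matrix m r \<beta> \<gamma> \<in> quarter_W_Z"
  using assms
  by (simp add: quarter_W_Z_def W_Q_def section_matrix_def transpose_def vec_eq_iff forall_4)

section \<open>Orthogonal equivalence with the section matrix\<close>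

text \<open>A one-sided inverse of a square matrix is two-sided, so
  \<open>transpose g ** A0 ** g = A0\<close> holds too. Thus g intertwines \<open>C ** A0\<close>
  with \<open>B ** A0\<close>, and \<open>C ** A0 ** C\<close> is the Gram matrix of the rows of
  \<open>g ** B\<close>.\<close>

lemma orthogonal_congruent_matrices:
  fixes g B C :: "complex ^ 4 ^ 4"
  assumes g: "g ** A0 ** transpose g = A0" and C: "C = g ** B ** transpose g"
  shows "C ** A0 ** g = g ** B ** A0" "transpose B = B \<Longrightarrow> C ** A0 ** C = (g ** B) ** A0 ** transpose (g ** B)"
proof -
  have "g ** (A0 ** transpose g ** A0) = mat 1"
    using g A0_square[where 'a = complex] by (simp add: matrix_mul_assoc)
  then have "A0 ** transpose g ** A0 ** g = mat 1"
    by (rule iffD1[OF matrix_left_right_inverse])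
  then have "A0 ** (A0 ** transpose g ** A0 ** g) = A0"
    by (simp only: matrix_mul_rid)
  then have *: "transpose g ** (A0 ** g) = A0"
    by (simp add: matrix_mul_assoc A0_square matrix_mul_lid)
  then have **: "transpose g ** (A0 ** (g ** X)) = A0 ** X" for X :: "complex ^ 4 ^ 4"
    by (metis matrix_mul_assoc)
  show "C ** A0 ** g = g ** B ** A0"
    by (simp only: C matrix_mul_assoc[symmetric] * **)
  show "C ** A0 ** C = (g ** B) ** A0 ** transpose (g ** B)" if "transpose B = B"
    unfolding matrix_transpose_mul that
    by (simp only: C matrix_mul_assoc[symmetric] * **)
qed

text \<open>The product in \<open>C123\<close> treats \<open>W00_Q\<close> and \<open>W01_Q\<close>
  together. Integrality is imposed only on products of two entries, since g itself may be
  irrational.\<close>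

locale equivalent_to_section =
  fixes m r \<beta> \<gamma> :: rat and a b :: int and g :: "complex ^ 4 ^ 4" and C :: "rat ^ 4 ^ 4"
  assumes m0: "m \<noteq> 0"
    and a: "of_int a = - 4 * r ^ 3 - 2 * m * \<beta>"
    and b: "of_int b = - (r ^ 4) - of_int a * r - m\<^sup>2 * \<gamma>"
    and irr: "irreducible (quartic a b)"
    and npc: "\<not> product_of_conjugate_quadratics (quartic a b)"
    and g: "g ** A0 ** transpose g = A0" "det g = 1"
    and integral: "\<And>i j k l. g $ i $ j * g $ k $ l \<in> \<int>"
    and C: "map_matrix of_rat C = g ** map_matrix of_rat (section_matrix m r \<beta> \<gamma>) ** transpose g"
    and sym: "transpose C = C"
    and C11: "C $ 1 $ 1 = 0" and C123: "C $ 1 $ 2 * C $ 1 $ 3 = 0"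
begin

abbreviation "cr \<equiv> (of_rat :: rat \<Rightarrow> complex)"

lemma gram:
  "g $ i $ 1 * g $ j $ 4 + g $ i $ 2 * g $ j $ 3 + g $ i $ 3 * g $ j $ 2 + g $ i $ 4 * g $ j $ 1
    = A0 $ i $ j"
  using arg_cong[OF g(1), of "\<lambda>M. M $ i $ j"] by (simp add: A0_gram)

lemma first_row: "g $ 1 $ 2 = 0" "g $ 1 $ 3 = 0" "g $ 1 $ 4 = 0" "g $ 1 $ 1 \<noteq> 0"
proof -
  let ?v1 = "g $ 1 $ 1" and ?v2 = "g $ 1 $ 2" and ?v3 = "g $ 1 $ 3" and ?v4 = "g $ 1 $ 4"
  have "2 * (?v1 * ?v4 + ?v2 * ?v3) = 0"
    using gram[of 1 1] by (simp add: A0_nth algebra_simps)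
  then have E1: "?v1 * ?v4 + ?v2 * ?v3 = 0" by (simp only: mult_eq_0_iff) simp
  have E2: "?v1 * (cr m * ?v3 + cr r * ?v4) + ?v2 * (?v2 - cr r * ?v3)
      + ?v3 * (cr m * ?v1 - cr r * ?v2 - 2 * (cr r)\<^sup>2 * ?v3 + cr \<beta> * ?v4)
      + ?v4 * (cr r * ?v1 + cr \<beta> * ?v3 + cr \<gamma> * ?v4) = 0"
    using arg_cong[OF C, of "\<lambda>M. M $ 1 $ 1"] C11
    by (simp add: matrix_matrix_mult_def sum_4 transpose_def section_matrix_def
        of_rat_mult of_rat_power of_rat_minus algebra_simps)
  \<comment> \<open>The square length of vT is the (1,1)-entry of C A0 C, that is 2 (c11 c14 + c12
    c13), which vanishes in both cases.\<close>
  have E3: "(cr m * ?v3 + cr r * ?v4) * (cr r * ?v1 + cr \<beta> * ?v3 + cr \<gamma> * ?v4)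
      + (?v2 - cr r * ?v3) * (cr m * ?v1 - cr r * ?v2 - 2 * (cr r)\<^sup>2 * ?v3 + cr \<beta> * ?v4) = 0"
  proof -
    have "C $ 2 $ 1 = C $ 1 $ 2" "C $ 3 $ 1 = C $ 1 $ 3"
      using arg_cong[OF sym, of "\<lambda>M. M $ 1 $ 2"] arg_cong[OF sym, of "\<lambda>M. M $ 1 $ 3"]
      by (simp_all add: transpose_def)
    moreover have "cr (C $ 1 $ 2) * cr (C $ 1 $ 3) = 0" using C123 by (simp flip: of_rat_mult)
    ultimately have CAC: "(map_matrix cr C ** A0 ** map_matrix cr C) $ 1 $ 1 = 0"
      using C11 by (simp add: matrix_matrix_mult_def sum_4 A0_nth mult_ac)
    let ?B = "map_matrix cr (section_matrix m r \<beta> \<gamma>)"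
    define w where "w = (g ** ?B) $ 1"
    have w: "w $ 1 = cr m * ?v3 + cr r * ?v4" "w $ 2 = ?v2 - cr r * ?v3"
      "w $ 3 = cr m * ?v1 - cr r * ?v2 - 2 * (cr r)\<^sup>2 * ?v3 + cr \<beta> * ?v4"
      "w $ 4 = cr r * ?v1 + cr \<beta> * ?v3 + cr \<gamma> * ?v4"
      by (simp_all add: w_def matrix_matrix_mult_def sum_4 section_matrix_def of_rat_mult
          of_rat_power of_rat_minus algebra_simps)
    have "transpose ?B = ?B"
      by (simp add: vec_eq_iff forall_4 transpose_def section_matrix_def)
    from orthogonal_congruent_matrices(2)[OF g(1) C this] CAC
    have "((g ** ?B) ** A0 ** transpose (g ** ?B)) $ 1 $ 1 = 0" by simp
    then have "2 * (w $ 1 * w $ 4 + w $ 2 * w $ 3) = 0"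
      by (simp add: A0_gram w_def algebra_simps)
    then show ?thesis unfolding w by (simp only: mult_eq_0_iff) simp
  qed
  have "\<exists>j. g $ 1 $ j \<noteq> 0"
  proof (rule ccontr)
    assume "\<nexists>j. g $ 1 $ j \<noteq> 0"
    then show False using gram[of 1 4] by (simp add: A0_nth)
  qed
  then obtain j where j: "g $ 1 $ j \<noteq> 0" by blast
  \<comment> \<open>Multiplying the row by one of its own nonzero entries makes it rational;
    \<open>E1\<close>, \<open>E2\<close>, \<open>E3\<close> are homogeneous of degree 2 in the row
    and survive the scaling.\<close>
  define l where "l = g $ 1 $ j"
  have "\<exists>q. cr q = l * g $ 1 $ k" for k
    using integral[of 1 j 1 k] unfolding l_def by (metis Ints_cases of_rat_of_int_eq)
  then obtain q where q: "\<And>k. cr (q k) = l * g $ 1 $ k" by metis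
  have "q 2 = 0 \<and> q 3 = 0 \<and> q 4 = 0"
  proof (rule isotropic_row_trivial[OF m0 a b irr npc])
    have "cr (q 1 * q 4 + q 2 * q 3)
      = l\<^sup>2 * (?v1 * ?v4 + ?v2 * ?v3)"
      unfolding of_rat_add of_rat_mult of_rat_diff of_rat_power of_rat_numeral_eq q by algebra
    also have "\<dots> = 0" by (simp only: E1 mult_zero_right)
    finally show "q 1 * q 4 + q 2 * q 3 = 0"
      by (simp only: of_rat_eq_0_iff)
    have "cr (q 1 * (m * q 3 + r * q 4) + q 2 * (q 2 - r * q 3)
      + q 3 * (m * q 1 - r * q 2 - 2 * r\<^sup>2 * q 3 + \<beta> * q 4)
      + q 4 * (r * q 1 + \<beta> * q 3 + \<gamma> * q 4))
      = l\<^sup>2 * (?v1 * (cr m * ?v3 + cr r * ?v4) + ?v2 * (?v2 - cr r * ?v3)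
      + ?v3 * (cr m * ?v1 - cr r * ?v2 - 2 * (cr r)\<^sup>2 * ?v3 + cr \<beta> * ?v4)
      + ?v4 * (cr r * ?v1 + cr \<beta> * ?v3 + cr \<gamma> * ?v4))"
      unfolding of_rat_add of_rat_mult of_rat_diff of_rat_power of_rat_numeral_eq q by algebra
    also have "\<dots> = 0" by (simp only: E2 mult_zero_right)
    finally show "q 1 * (m * q 3 + r * q 4) + q 2 * (q 2 - r * q 3)
      + q 3 * (m * q 1 - r * q 2 - 2 * r\<^sup>2 * q 3 + \<beta> * q 4)
      + q 4 * (r * q 1 + \<beta> * q 3 + \<gamma> * q 4) = 0"
      by (simp only: of_rat_eq_0_iff)
    have "cr ((m * q 3 + r * q 4) * (r * q 1 + \<beta> * q 3 + \<gamma> * q 4)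
      + (q 2 - r * q 3) * (m * q 1 - r * q 2 - 2 * r\<^sup>2 * q 3 + \<beta> * q 4))
      = l\<^sup>2 * ((cr m * ?v3 + cr r * ?v4) * (cr r * ?v1 + cr \<beta> * ?v3 + cr \<gamma> * ?v4)
      + (?v2 - cr r * ?v3) * (cr m * ?v1 - cr r * ?v2 - 2 * (cr r)\<^sup>2 * ?v3 + cr \<beta> * ?v4))"
      unfolding of_rat_add of_rat_mult of_rat_diff of_rat_power of_rat_numeral_eq q by algebra
    also have "\<dots> = 0" by (simp only: E3 mult_zero_right)
    finally show "(m * q 3 + r * q 4) * (r * q 1 + \<beta> * q 3 + \<gamma> * q 4)
      + (q 2 - r * q 3) * (m * q 1 - r * q 2 - 2 * r\<^sup>2 * q 3 + \<beta> * q 4) = 0"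
      by (simp only: of_rat_eq_0_iff)
  qed
  then have "l * g $ 1 $ 2 = 0" "l * g $ 1 $ 3 = 0" "l * g $ 1 $ 4 = 0"
    using q by (metis of_rat_0)+
  then show "g $ 1 $ 2 = 0" "g $ 1 $ 3 = 0" "g $ 1 $ 4 = 0" using j by (simp_all add: l_def)
  then show "g $ 1 $ 1 \<noteq> 0" using gram[of 1 4] by (auto simp: A0_nth)
qed

text \<open>First row of the intertwining relation: since that row of g is g11 e_1, the right side
  is g11 e_1 T = g11 (r e_1 + m e_2).\<close>

lemma row_relation:
  "cr (C $ 1 $ 3) * g $ 2 $ j + cr (C $ 1 $ 2) * g $ 3 $ j + cr (C $ 1 $ 4) * g $ 1 $ j
    = g $ 1 $ 1 * (if j = 1 then cr r else if j = 2 then cr m else 0)"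
proof -
  have "\<forall>j. cr (C $ 1 $ 3) * g $ 2 $ j + cr (C $ 1 $ 2) * g $ 3 $ j + cr (C $ 1 $ 4) * g $ 1 $ j
    = g $ 1 $ 1 * (if j = 1 then cr r else if j = 2 then cr m else 0)"
    using arg_cong[OF orthogonal_congruent_matrices(1)[OF g(1) C], of "\<lambda>M. M $ 1"] C11
    by (simp add: forall_4 vec_eq_iff matrix_matrix_mult_def sum_4 transpose_def section_matrix_def
        A0_nth first_row algebra_simps)
  then show ?thesis by blast
qed

text \<open>The relation c13 g22 = g11 m and g11 g44 = 1 give c13 (g22 g44) = m. The factor g22 g44
  is an integral unit, with inverse g11 g33.\<close>

lemma entry_W00:
  assumes "C $ 1 $ 2 = 0"
  shows "\<bar>C $ 1 $ 3\<bar> = \<bar>m\<bar>"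
proof -
  have rel: "cr (C $ 1 $ 3) * g $ 2 $ 2 = g $ 1 $ 1 * cr m"
    "cr (C $ 1 $ 3) * g $ 2 $ 3 = 0" "cr (C $ 1 $ 3) * g $ 2 $ 4 = 0"
    using row_relation[of 2] row_relation[of 3] row_relation[of 4] assms first_row by simp_all
  then have "C $ 1 $ 3 \<noteq> 0" using m0 first_row by auto
  with rel have g2: "g $ 2 $ 3 = 0" "g $ 2 $ 4 = 0" by simp_all
  have g14: "g $ 1 $ 1 * g $ 4 $ 4 = 1" and g34: "g $ 3 $ 4 = 0"
    using gram[of 1 4] gram[of 1 3] first_row by (simp_all add: A0_nth)
  have g23: "g $ 2 $ 2 * g $ 3 $ 3 = 1"
    using gram[of 2 3] g34 g2 by (simp add: A0_nth)
  obtain n n' :: int where n: "g $ 1 $ 1 * g $ 3 $ 3 = of_int n" and n': "g $ 2 $ 2 * g $ 4 $ 4 = of_int n'"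
    using integral[of 1 1 3 3] integral[of 2 2 4 4] by (elim Ints_cases)
  have "(of_int (n * n') :: complex) = (g $ 1 $ 1 * g $ 4 $ 4) * (g $ 2 $ 2 * g $ 3 $ 3)"
    by (simp add: flip: n n')
  then have "(of_int (n * n') :: complex) = of_int 1" by (simp add: g14 g23)
  then have "\<bar>n'\<bar> = 1" unfolding of_int_eq_iff by (auto simp: zmult_eq_1_iff)
  have "cr (C $ 1 $ 3 * of_int n') = cr m"
    using rel(1) g14 by (simp add: of_rat_mult flip: n') algebra
  then have "C $ 1 $ 3 * of_int n' = m" unfolding of_rat_eq_iff .
  then have "\<bar>m\<bar> = \<bar>C $ 1 $ 3\<bar> * \<bar>of_int n'\<bar>" using abs_mult by metis
  with \<open>\<bar>n'\<bar> = 1\<close> show ?thesis by (simp flip: of_int_abs)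
qed

text \<open>The isotropic planes of e_1, e_2 and of e_1, e_3 belong to opposite rulings of the
  quadric, which determinant 1 cannot exchange; here the determinant comes out as -1.\<close>

lemma not_W01:
  assumes "C $ 1 $ 3 = 0"
  shows False
proof -
  have rel: "cr (C $ 1 $ 2) * g $ 3 $ 2 = g $ 1 $ 1 * cr m"
    "cr (C $ 1 $ 2) * g $ 3 $ 3 = 0" "cr (C $ 1 $ 2) * g $ 3 $ 4 = 0"
    using row_relation[of 2] row_relation[of 3] row_relation[of 4] assms first_row by simp_all
  then have "C $ 1 $ 2 \<noteq> 0" using m0 first_row by auto
  with rel have g3: "g $ 3 $ 3 = 0" "g $ 3 $ 4 = 0" by simp_all
  have g14: "g $ 1 $ 1 * g $ 4 $ 4 = 1" and g24: "g $ 2 $ 4 = 0"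
    using gram[of 1 4] gram[of 1 2] first_row by (simp_all add: A0_nth)
  have g23: "g $ 2 $ 3 * g $ 3 $ 2 = 1"
    using gram[of 2 3] g24 g3 by (simp add: A0_nth)
  have "det g = - ((g $ 1 $ 1 * g $ 4 $ 4) * (g $ 2 $ 3 * g $ 3 $ 2))"
    by (simp add: det_4 first_row g3 g24)
  also have "\<dots> = - 1" by (simp add: g14 g23)
  finally show False using g(2) by simp
qed

end

text \<open>In even size, negation preserves the determinant, so either representative of the class
  lies in \<open>SO_A0\<close>.\<close>

lemma G_Z_equivalentE:
  assumes "G_Z_equivalent B C"
  obtains g :: "complex ^ 4 ^ 4" where "g ** A0 ** transpose g = A0" "det g = 1"
    "\<And>i j k l. g $ i $ j * g $ k $ l \<in> \<int>"
    "map_matrix of_rat C = g ** map_matrix of_rat B ** transpose g"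
proof -
  obtain X g where X: "X \<in> G_Z" "g \<in> X" and C: "map_matrix of_rat C = g ** map_matrix of_rat B ** transpose g"
    using assms unfolding G_Z_equivalent_def by blast
  obtain h where h: "h \<in> SO_A0" "X = {h, - h}" using X by (auto simp: G_Z_def PSO_A0_def)
  have "det (- h) = det h" unfolding det_4 vector_uminus_component by algebra
  moreover have "(- h) ** A0 ** transpose (- h) = h ** A0 ** transpose h"
    by (simp add: vec_eq_iff forall_4 matrix_matrix_mult_def sum_4 transpose_def A0_nth)
  ultimately have "g \<in> SO_A0" using h X by (auto simp: SO_A0_def)
  with C X show thesis by (intro that[of g]) (auto simp: SO_A0_def G_Z_def)
qed

section \<open>Choice of the root and construction of the map\<close>

theorem theorem2p4:
  fixes m :: int
  assumes "squarefree m"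
  shows "\<exists>\<sigma> :: int \<times> int \<Rightarrow> rat ^ 4 ^ 4.
    (\<forall>(a, b) \<in> W_weak m.
       \<sigma> (a, b) \<in> quarter_W_Z \<and> inv_poly (\<sigma> (a, b)) = quartic a b) \<and>
    (\<forall>(a, b) \<in> W_weak_irr m.
       (\<forall>B \<in> W00_Q. G_Z_equivalent (\<sigma> (a, b)) B \<longrightarrow> \<bar>B $ 1 $ 3\<bar> = of_int \<bar>m\<bar>) \<and>
       (\<forall>B \<in> W01_Q. G_Z_equivalent (\<sigma> (a, b)) B \<longrightarrow> \<bar>B $ 1 $ 2\<bar> = of_int \<bar>m\<bar>))"
proof -
  have m0: "m \<noteq> 0" using assms by auto
  define dbl where "dbl a b r \<longleftrightarrow> m dvd 4 * r ^ 3 + a \<and> m\<^sup>2 dvd r ^ 4 + a * r + b" for a b r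
  define root where "root a b = (SOME r. dbl a b r)" for a b
  \<comment> \<open>Defining \<open>\<beta>\<close> and \<open>\<gamma>\<close> by division gives
    the Taylor identities at every (a,b); the double root property makes 2\<open>\<beta>\<close> and
    \<open>\<gamma>\<close> integers on \<open>W_weak m\<close>.\<close>
  define \<beta> where "\<beta> a b = - of_int (4 * root a b ^ 3 + a) / (2 * of_int m :: rat)" for a b
  define \<gamma> where "\<gamma> a b = - of_int (root a b ^ 4 + a * root a b + b) / (of_int m ^ 2 :: rat)" for a b
  define \<sigma> where "\<sigma> = (\<lambda>(a, b). section_matrix (of_int m) (of_int (root a b)) (\<beta> a b) (\<gamma> a b))"
  have a: "of_int a = - 4 * of_int (root a b) ^ 3 - 2 * of_int m * \<beta> a b" for a b
    using m0 by (simp add: \<beta>_def)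
  have b: "of_int b = - (of_int (root a b) ^ 4) - of_int a * of_int (root a b) - (of_int m)\<^sup>2 * \<gamma> a b" for a b
    using m0 by (simp add: \<gamma>_def)
  have quarter: "\<sigma> (a, b) \<in> quarter_W_Z" if ab: "(a, b) \<in> W_weak m" for a b
  proof -
    have "\<exists>r. dbl a b r" unfolding dbl_def by (rule W_weak_double_root[OF assms ab])
    then have "dbl a b (root a b)" unfolding root_def by (rule someI_ex)
    then obtain k n where kn: "4 * root a b ^ 3 + a = m * k" "root a b ^ 4 + a * root a b + b = m\<^sup>2 * n"
      by (auto simp: dbl_def elim!: dvdE)
    have "4 * \<beta> a b = of_int (- 2 * k)" unfolding \<beta>_def kn using m0 by simp
    moreover have "4 * \<gamma> a b = of_int (- 4 * n)" unfolding \<gamma>_def kn using m0 by simp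
    ultimately show ?thesis
      unfolding \<sigma>_def prod.case
      by (intro section_matrix_in_quarter_W_Z) (simp_all only: Ints_of_int, simp_all)
  qed
  have inv: "inv_poly (\<sigma> (a, b)) = quartic a b" for a b
    unfolding \<sigma>_def prod.case by (rule inv_poly_section_matrix[OF a b])
  have equiv: "equivalent_to_section (of_int m) (of_int (root a b)) (\<beta> a b) (\<gamma> a b) a b g C"
    if "(a, b) \<in> W_weak_irr m" "C \<in> W_Q" "C $ 1 $ 1 = 0" "C $ 1 $ 2 * C $ 1 $ 3 = 0"
      "g ** A0 ** transpose g = A0" "det g = 1" "\<And>i j k l. g $ i $ j * g $ k $ l \<in> \<int>"
      "map_matrix of_rat C = g ** map_matrix of_rat (\<sigma> (a, b)) ** transpose g" for a b C g
    by (intro equivalent_to_section.intro a b)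
      (use that m0 in \<open>simp_all add: W_weak_irr_def W_Q_def \<sigma>_def\<close>)
  have W00: "\<bar>C $ 1 $ 3\<bar> = of_int \<bar>m\<bar>"
    if "(a, b) \<in> W_weak_irr m" "C \<in> W00_Q" "G_Z_equivalent (\<sigma> (a, b)) C" for a b C
    using that(3)
  proof (rule G_Z_equivalentE)
    fix g :: "complex ^ 4 ^ 4"
    assume g: "g ** A0 ** transpose g = A0" "det g = 1" "\<And>i j k l. g $ i $ j * g $ k $ l \<in> \<int>"
      "map_matrix of_rat C = g ** map_matrix of_rat (\<sigma> (a, b)) ** transpose g"
    interpret equivalent_to_section "of_int m" "of_int (root a b)" "\<beta> a b" "\<gamma> a b" a b g C
      by (rule equiv[OF that(1) _ _ _ g]) (use that(2) in \<open>simp_all add: W00_Q_def\<close>)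
    show ?thesis using entry_W00 that(2) by (simp add: W00_Q_def)
  qed
  have W01: False
    if "(a, b) \<in> W_weak_irr m" "C \<in> W01_Q" "G_Z_equivalent (\<sigma> (a, b)) C" for a b C
    using that(3)
  proof (rule G_Z_equivalentE)
    fix g :: "complex ^ 4 ^ 4"
    assume g: "g ** A0 ** transpose g = A0" "det g = 1" "\<And>i j k l. g $ i $ j * g $ k $ l \<in> \<int>"
      "map_matrix of_rat C = g ** map_matrix of_rat (\<sigma> (a, b)) ** transpose g"
    interpret equivalent_to_section "of_int m" "of_int (root a b)" "\<beta> a b" "\<gamma> a b" a b g C
      by (rule equiv[OF that(1) _ _ _ g]) (use that(2) in \<open>simp_all add: W01_Q_def\<close>)
    show False using not_W01 that(2) by (simp add: W01_Q_def)
  qed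
  show ?thesis
  proof (intro exI[of _ \<sigma>] conjI ballI case_prodI2 impI)
    fix x a b
    assume "x \<in> W_weak m" "x = (a, b)"
    then show "\<sigma> (a, b) \<in> quarter_W_Z" "inv_poly (\<sigma> (a, b)) = quartic a b"
      using quarter inv by simp_all
  next
    fix x a b C
    assume *: "x \<in> W_weak_irr m" "x = (a, b)" "G_Z_equivalent (\<sigma> (a, b)) C"
    show "\<bar>C $ 1 $ 3\<bar> = of_int \<bar>m\<bar>" if "C \<in> W00_Q" using W00[of a b C] * that by simp
    show "\<bar>C $ 1 $ 2\<bar> = of_int \<bar>m\<bar>" if "C \<in> W01_Q" using W01[of a b C] * that by simp
  qed
qed

end
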